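(* Let $(\mathcal F,\mathcal G)$ be a well-behaved tiling IFS (with respect to a set $\mathcal U$ of isometries of $\mathbb R^M$). If $\Pi(\theta)=E\,\Pi(\psi)$ for some isometry $E\in\mathcal U$ and $\theta,\psi\in\Sigma_\infty^\dagger$, then there are $p,q\in\mathbb N$, $h,e\in\mathcal E$ and $l\in\{0,1,\dots,a_{\max}-1\}$ such that $$E=f_{-(\theta|p)}\;s^l\,f_h\,V_{h^+e^+}\,f_e^{-1}\,(f_{-(\psi|q)})^{-1},$$ where $h^-=(\theta|p)^+$, $e^-=(\psi|q)^+$, and $V_{h^+e^+}$ is a similitude such that $V_{h^+e^+}A_{e^+}=A_{h^+}$.
   Context: Graph and paths. $\mathcal G=(\mathcal E,\mathcal V)$ is a finite directed graph with edges $1,\dots,N$ and vertices $\mathcal V$, $1\le|\mathcal V|<N$, strongly connected and primitive (some power of its adjacency matrix is strictly positive). An edge $e$ goes from $e^-$ to $e^+$ and is associated with a map $f_e:\mathbb R^M\to\mathbb R^M$, $\mathcal F=\{f_1,\dots,f_N\}$. $\Sigma_*$ (resp. $\Sigma_\infty$) is the set of finite (resp. infinite) directed paths $\sigma=\sigma_1\sigma_2\cdots$ in $\mathcal G$; $\sigma^-$ is the initial vertex and, for finite $\sigma$, $\sigma^+$ is the terminal vertex and $f_\sigma=f_{\sigma_1}\circ\cdots\circ f_{\sigma_{|\sigma|}}$. $\mathcal G^\dagger$ is $\mathcal G$ with all edges reversed (same labels); $\Sigma_*^\dagger,\Sigma_\infty^\dagger$ are its finite and infinite directed paths. For a path $\theta$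 in $\mathcal G^\dagger$, $\theta^-,\theta^+$ are its initial and terminal vertices as a path in $\mathcal G^\dagger$ (so $\theta^-$ is the $\mathcal G$-terminal vertex of the edge $\theta_1$ and, for finite $\theta$, $\theta^+$ is the $\mathcal G$-initial vertex of its last edge), $f_{-\theta}=f_{\theta_1}^{-1}\circ\cdots\circ f_{\theta_{|\theta|}}^{-1}$, $\theta|k=\theta_1\cdots\theta_k$, $\theta|0$ is the empty path at $\theta^-$. For single edges $h,e$ of $\mathcal E$, $h^\pm,e^\pm$ are taken in $\mathcal G$. Attractor. $\pi(\sigma)=\lim_k f_{\sigma_1}\cdots f_{\sigma_k}(x)$ for $\sigma\in\Sigma_\infty$ (independent of $x$), $A_v=\{\pi(\sigma):\sigma\in\Sigma_\infty,\sigma^-=v\}$ for $v\in\mathcal V$, and $\pi(\sigma)=f_\sigma(A_{\sigma^+})$ for $\sigma\in\Sigma_*$. Tiling IFS. $(\mathcal F,\mathcal G)$ is a tiling IFS if each $f_n$ is a contractive similitude with scaling factor $s^{a_n}$, where $0<s<1$ is fixed, $a_n\in\mathbb N=\{1,2,\dots\}$ and $\gcd(a_1,\dots,a_N)=1$; the open set condition holds (there are nonempty bounded open sets $\mathcal O_v$, $v\in\mathcal V$, with $f_e(\mathcal O_{e^+})\subset\mathcal O_{e^-}$ for all $e$, and $f_e(\mathcal O_{e^+})\cap f_d(\mathcal O_{d^+})=\varnothing$ whenever $d\ne e$, $d^-=e^-$); $A_v\cap A_w=\varnothing$ for $v\neq w$; and the affine span of each $A_v$ is $\mathbb R^M$.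 Put $a_{\max}=\max_n a_n$. Tilings. For a finite path, $\xi(\sigma)=\sum_{i=1}^{|\sigma|}a_{\sigma_i}$, $\xi^-(\sigma)=\sum_{i=1}^{|\sigma|-1}a_{\sigma_i}$ (both $0$ for the empty path). For $k\in\mathbb N_0$, $\Omega_k^v=\{\sigma\in\Sigma_*:\xi^-(\sigma)\le k<\xi(\sigma),\ \sigma^-=v\}$. For $\theta\in\Sigma^\dagger_*$, $\Pi(\theta)=\{f_{-\theta}(\pi(\sigma)):\sigma\in\Omega^{\theta^+}_{\xi(\theta)}\}$; for $\theta\in\Sigma^\dagger_\infty$, $\Pi(\theta)=\bigcup_{k\in\mathbb N}\Pi(\theta|k)$. For a collection $T$ of sets and a map $g$, $gT=\{g(t):t\in T\}$; $s$ also denotes the map $x\mapsto sx$. Canonical tilings: $T_k^v=s^{-k}\{\pi(\sigma):\sigma\in\Omega_k^v\}$ for $k\in\mathbb N_0$. Deflation. For a specified isometry $E$, specified $\theta\in\Sigma_\infty^\dagger$ and $K\in\mathbb N_0$, $$\alpha^K(E\Pi(\theta))=\bigcup_{k:\ \xi(\theta|k)\ge K}s^KE f_{-(\theta|k)}s^{\xi(\theta|k)-K}T^{(\theta|k)^+}_{\xi(\theta|k)-K}$$ (an increasing union; the result is defined from the pair $(E,\theta)$). Well-behaved. $\mathcal U$ is a set of isometries of $\mathbb R^M$. $(\mathcal F,\mathcal G)$ is well-behaved (with respect to $\mathcal U$) if for all $\theta,\psi\in\Sigma_\infty^\dagger$ and $E\in\mathcal U$: $\Pi(\theta)=E\Pi(\psi)$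 implies $\alpha^k(\Pi(\theta))=\alpha^k(E\Pi(\psi))$ for all $k\in\mathbb N$. *)

theory Defs
  imports "HOL-Analysis.Analysis" "Graph_Theory.Graph_Theory"
begin

text \<open>
  Edges are the arcs of a \<^typ>\<open>('v, nat) pre_digraph\<close> (loops and parallel edges allowed), numbered
  from 1 to \<open>N\<close>; edge \<open>e\<close> runs from \<open>e\<^sup>- = tail G e\<close> to \<open>e\<^sup>+ = head G e\<close>.
\<close>

definition adjacency :: "('v, 'e) pre_digraph \<Rightarrow> 'v \<Rightarrow> 'v \<Rightarrow> nat" where
  "adjacency G u v = card {e \<in> arcs G. tail G e = u \<and> head G e = v}"

primrec adjacency_power :: "('v, 'e) pre_digraph \<Rightarrow> nat \<Rightarrow> 'v \<Rightarrow> 'v \<Rightarrow> nat" where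
  "adjacency_power G 0 u v = (if u = v then 1 else 0)"
| "adjacency_power G (Suc n) u v = (\<Sum>w\<in>verts G. adjacency G u w * adjacency_power G n w v)"

definition primitive :: "('v, 'e) pre_digraph \<Rightarrow> bool" where
  "primitive G \<longleftrightarrow> (\<exists>n\<ge>1. \<forall>u\<in>verts G. \<forall>v\<in>verts G. adjacency_power G n u v > 0)"

definition ifs_graph :: "nat \<Rightarrow> ('v, nat) pre_digraph \<Rightarrow> bool" where
  "ifs_graph N G \<longleftrightarrow> fin_digraph G \<and> arcs G = {1..N} \<and> 1 \<le> card (verts G) \<and> card (verts G) < N \<and>
     strongly_connected G \<and> primitive G"

definition reversal :: "('v, 'e) pre_digraph \<Rightarrow> ('v, 'e) pre_digraph" where
  "reversal G = \<lparr>verts = verts G, arcs = arcs G, tail = head G, head = tail G\<rparr>"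

text \<open>
  An infinite path \<open>\<sigma>\<^sub>1 \<sigma>\<^sub>2 \<dots>\<close> is a sequence indexed from 0, so \<open>\<sigma>\<^sub>i\<close> is \<open>\<sigma> (i - 1)\<close>. A finite path
  is an arc walk of the graph library, a list of arcs accompanied by its initial vertex,
  so that empty paths have end points too.
\<close>

definition inf_paths :: "('v, 'e) pre_digraph \<Rightarrow> (nat \<Rightarrow> 'e) set" where
  "inf_paths G = {\<sigma>. \<forall>i. \<sigma> i \<in> arcs G \<and> head G (\<sigma> i) = tail G (\<sigma> (Suc i))}"

definition path_prefix :: "(nat \<Rightarrow> 'e) \<Rightarrow> nat \<Rightarrow> 'e list" where
  "path_prefix \<sigma> k = map \<sigma> [0..<k]"

text \<open>
  The terminal vertex \<open>(\<sigma>|k)\<^sup>+\<close>, all end points being taken in the graph argument; paths in the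
  reversed graph are passed with \<open>reversal G\<close>.
\<close>

definition prefix_end :: "('v, 'e) pre_digraph \<Rightarrow> (nat \<Rightarrow> 'e) \<Rightarrow> nat \<Rightarrow> 'v" where
  "prefix_end G \<sigma> k = pre_digraph.awlast G (tail G (\<sigma> 0)) (path_prefix \<sigma> k)"

definition path_map :: "('e \<Rightarrow> 'a \<Rightarrow> 'a) \<Rightarrow> 'e list \<Rightarrow> 'a \<Rightarrow> 'a" where
  "path_map f \<sigma> = foldr (\<lambda>e g. f e \<circ> g) \<sigma> id"

text \<open>\<open>f\<^sub>-\<^sub>\<theta>\<close>: the inverses are composed in the order of the path, so this is in general not
  the inverse of \<open>f\<^sub>\<theta>\<close>.\<close>

definition neg_path_map :: "('e \<Rightarrow> 'a \<Rightarrow> 'a) \<Rightarrow> 'e list \<Rightarrow> 'a \<Rightarrow> 'a" where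
  "neg_path_map f \<theta> = foldr (\<lambda>e g. inv (f e) \<circ> g) \<theta> id"

definition address_point :: "('e \<Rightarrow> 'a::real_normed_vector \<Rightarrow> 'a) \<Rightarrow> (nat \<Rightarrow> 'e) \<Rightarrow> 'a" where
  "address_point f \<sigma> = lim (\<lambda>k. path_map f (path_prefix \<sigma> k) 0)"

definition attractor ::
  "('v, 'e) pre_digraph \<Rightarrow> ('e \<Rightarrow> 'a::real_normed_vector \<Rightarrow> 'a) \<Rightarrow> 'v \<Rightarrow> 'a set" where
  "attractor G f v = {address_point f \<sigma> | \<sigma>. \<sigma> \<in> inf_paths G \<and> tail G (\<sigma> 0) = v}"

text \<open>\<open>\<pi>(\<sigma>)\<close> for a finite path \<open>\<sigma>\<close> with initial vertex \<open>v\<close>.\<close>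

definition tile ::
  "('v, 'e) pre_digraph \<Rightarrow> ('e \<Rightarrow> 'a::real_normed_vector \<Rightarrow> 'a) \<Rightarrow> 'v \<Rightarrow> 'e list \<Rightarrow> 'a set" where
  "tile G f v \<sigma> = path_map f \<sigma> ` attractor G f (pre_digraph.awlast G v \<sigma>)"

text \<open>In finite dimension both notions below imply surjectivity, and they include
  orientation-reversing maps.\<close>

definition similitude_with :: "real \<Rightarrow> ('a::metric_space \<Rightarrow> 'a) \<Rightarrow> bool" where
  "similitude_with r g \<longleftrightarrow> r > 0 \<and> (\<forall>x y. dist (g x) (g y) = r * dist x y)"

definition similitude :: "('a::metric_space \<Rightarrow> 'a) \<Rightarrow> bool" where
  "similitude g \<longleftrightarrow> (\<exists>r. similitude_with r g)"

definition isometry :: "('a::metric_space \<Rightarrow> 'a) \<Rightarrow> bool" where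
  "isometry g \<longleftrightarrow> (\<forall>x y. dist (g x) (g y) = dist x y)"

definition open_set_condition ::
  "('v, 'e) pre_digraph \<Rightarrow> ('e \<Rightarrow> 'a::metric_space \<Rightarrow> 'a) \<Rightarrow> bool" where
  "open_set_condition G f \<longleftrightarrow> (\<exists>U :: 'v \<Rightarrow> 'a set.
     (\<forall>v\<in>verts G. U v \<noteq> {} \<and> bounded (U v) \<and> open (U v)) \<and>
     (\<forall>e\<in>arcs G. f e ` U (head G e) \<subseteq> U (tail G e)) \<and>
     (\<forall>e\<in>arcs G. \<forall>d\<in>arcs G. d \<noteq> e \<and> tail G d = tail G e \<longrightarrow>
        f e ` U (head G e) \<inter> f d ` U (head G d) = {}))"

definition tiling_IFS ::
  "nat \<Rightarrow> ('v, nat) pre_digraph \<Rightarrow> (nat \<Rightarrow> real ^ 'm \<Rightarrow> real ^ 'm) \<Rightarrow> real \<Rightarrow> (nat \<Rightarrow> nat) \<Rightarrow> bool" where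
  "tiling_IFS N G f s a \<longleftrightarrow> ifs_graph N G \<and> 0 < s \<and> s < 1 \<and>
     (\<forall>n\<in>{1..N}. a n \<ge> 1 \<and> similitude_with (s ^ a n) (f n)) \<and>
     Gcd (a ` {1..N}) = 1 \<and>
     open_set_condition G f \<and>
     (\<forall>v\<in>verts G. \<forall>w\<in>verts G. v \<noteq> w \<longrightarrow> attractor G f v \<inter> attractor G f w = {}) \<and>
     (\<forall>v\<in>verts G. affine hull (attractor G f v) = UNIV)"

definition \<xi> :: "('e \<Rightarrow> nat) \<Rightarrow> 'e list \<Rightarrow> nat" where
  "\<xi> a \<sigma> = sum_list (map a \<sigma>)"

definition \<xi>_minus :: "('e \<Rightarrow> nat) \<Rightarrow> 'e list \<Rightarrow> nat" where
  "\<xi>_minus a \<sigma> = sum_list (map a (butlast \<sigma>))"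

definition \<Omega> :: "('v, 'e) pre_digraph \<Rightarrow> ('e \<Rightarrow> nat) \<Rightarrow> 'v \<Rightarrow> nat \<Rightarrow> 'e list set" where
  "\<Omega> G a v k = {\<sigma>. (\<exists>w. pre_digraph.awalk G v \<sigma> w) \<and> \<xi>_minus a \<sigma> \<le> k \<and> k < \<xi> a \<sigma>}"

text \<open>The image \<open>g T\<close> of a collection \<open>T\<close> of sets.\<close>

definition map_tiles :: "('a \<Rightarrow> 'a) \<Rightarrow> 'a set set \<Rightarrow> 'a set set" where
  "map_tiles g T = (\<lambda>t. g ` t) ` T"

text \<open>\<open>\<Pi>(\<theta>|k)\<close> and \<open>\<Pi>(\<theta>)\<close> for an infinite path \<open>\<theta>\<close> of \<open>reversal G\<close>.\<close>

definition prefix_tiling ::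
  "('v, 'e) pre_digraph \<Rightarrow> ('e \<Rightarrow> 'a::real_normed_vector \<Rightarrow> 'a) \<Rightarrow> ('e \<Rightarrow> nat) \<Rightarrow>
    (nat \<Rightarrow> 'e) \<Rightarrow> nat \<Rightarrow> 'a set set" where
  "prefix_tiling G f a \<theta> k =
     (let v = prefix_end (reversal G) \<theta> k in
      {neg_path_map f (path_prefix \<theta> k) ` tile G f v \<sigma> | \<sigma>. \<sigma> \<in> \<Omega> G a v (\<xi> a (path_prefix \<theta> k))})"

definition tiling ::
  "('v, 'e) pre_digraph \<Rightarrow> ('e \<Rightarrow> 'a::real_normed_vector \<Rightarrow> 'a) \<Rightarrow> ('e \<Rightarrow> nat) \<Rightarrow>
    (nat \<Rightarrow> 'e) \<Rightarrow> 'a set set" where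
  "tiling G f a \<theta> = (\<Union>k\<in>{1..}. prefix_tiling G f a \<theta> k)"

definition canonical_tiling ::
  "('v, 'e) pre_digraph \<Rightarrow> ('e \<Rightarrow> 'a::real_normed_vector \<Rightarrow> 'a) \<Rightarrow> real \<Rightarrow> ('e \<Rightarrow> nat) \<Rightarrow>
    'v \<Rightarrow> nat \<Rightarrow> 'a set set" where
  "canonical_tiling G f s a v k =
     map_tiles (\<lambda>x. inverse (s ^ k) *\<^sub>R x) {tile G f v \<sigma> | \<sigma>. \<sigma> \<in> \<Omega> G a v k}"

text \<open>\<open>\<alpha>\<^sup>K(E\<Pi>(\<theta>))\<close>, a function of the pair \<open>(E, \<theta>)\<close> and not of the tiling \<open>E\<Pi>(\<theta>)\<close> alone.\<close>

definition deflation ::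
  "('v, 'e) pre_digraph \<Rightarrow> ('e \<Rightarrow> 'a::real_normed_vector \<Rightarrow> 'a) \<Rightarrow> real \<Rightarrow> ('e \<Rightarrow> nat) \<Rightarrow>
    nat \<Rightarrow> ('a \<Rightarrow> 'a) \<Rightarrow> (nat \<Rightarrow> 'e) \<Rightarrow> 'a set set" where
  "deflation G f s a K E \<theta> =
     (\<Union>k\<in>{k. K \<le> \<xi> a (path_prefix \<theta> k)}.
        map_tiles
          ((\<lambda>x. s ^ K *\<^sub>R x) \<circ> E \<circ> neg_path_map f (path_prefix \<theta> k)
             \<circ> (\<lambda>x. s ^ (\<xi> a (path_prefix \<theta> k) - K) *\<^sub>R x))
          (canonical_tiling G f s a (prefix_end (reversal G) \<theta> k) (\<xi> a (path_prefix \<theta> k) - K)))"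

definition well_behaved ::
  "('v, 'e) pre_digraph \<Rightarrow> ('e \<Rightarrow> 'a::real_normed_vector \<Rightarrow> 'a) \<Rightarrow> real \<Rightarrow> ('e \<Rightarrow> nat) \<Rightarrow>
    ('a \<Rightarrow> 'a) set \<Rightarrow> bool" where
  "well_behaved G f s a \<U> \<longleftrightarrow>
     (\<forall>\<theta>\<in>inf_paths (reversal G). \<forall>\<psi>\<in>inf_paths (reversal G). \<forall>E\<in>\<U>.
        tiling G f a \<theta> = map_tiles E (tiling G f a \<psi>) \<longrightarrow>
        (\<forall>k\<ge>1. deflation G f s a k id \<theta> = deflation G f s a k E \<psi>))"

end

theory Submission
  imports Defs "HOL-Library.Sublist"
begin

text \<open>
  Put \<open>C\<^sub>k(\<theta>) = f\<^bsub>-(\<theta>|k)\<^esub>(A\<^sub>v)\<close> with \<open>v = (\<theta>|k)\<^sup>+\<close>, an increasing sequence of sets, each of which is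
  a tile of the deflations (before rescaling) at all levels between \<open>\<xi>(\<theta>|k) + 1\<close> and
  \<open>\<xi>(\<theta>|k+1)\<close>. It suffices to find \<open>k\<close> and \<open>j\<close> with \<open>E(C\<^sub>j(\<psi>)) = C\<^sub>k(\<theta>)\<close>: since
  \<open>f\<^bsub>-(\<theta>|k)\<^esub> = f\<^bsub>-(\<theta>|k+1)\<^esub> f\<^sub>h\<close> for the last edge \<open>h\<close> of \<open>\<theta>|k+1\<close>, the claim follows with \<open>p = k + 1\<close>,
  \<open>q = j + 1\<close>, \<open>l = 0\<close> and \<open>V = f\<^bsub>-(\<theta>|k)\<^esub>\<^sup>-\<^sup>1 E f\<^bsub>-(\<psi>|j)\<^esub>\<close>.

  Such \<open>k\<close> and \<open>j\<close> exist because a tile of one level is contained in only one tile of a given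
  higher level. This rests on the open set condition alone: by a volume comparison the number of
  addresses of a point is bounded, and an overlap of two incomparable tiles that contains a whole
  tile would reproduce itself inside that tile, multiplying the addresses beyond any bound.
\<close>

section \<open>Similitudes\<close>

lemma similitude_with_id: "similitude_with 1 id"
  by (simp add: similitude_with_def)

lemma similitude_with_comp:
  "similitude_with q g \<Longrightarrow> similitude_with r h \<Longrightarrow> similitude_with (q * r) (g \<circ> h)"
  by (simp add: similitude_with_def)

lemma similitude_with_dist: "similitude_with r g \<Longrightarrow> dist (g x) (g y) = r * dist x y"
  by (simp add: similitude_with_def)

text \<open>Dividing by the factor and moving the image of 0 to the origin leaves a
  distance-preserving map that fixes 0. Such a map is orthogonal, hence bijective in finite
  dimension.\<close>

lemma similitude_with_bij:
  fixes g :: "'a::euclidean_space \<Rightarrow> 'a"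
  assumes "similitude_with r g"
  shows "bij g"
proof -
  have r: "r > 0" and d: "\<And>x y. dist (g x) (g y) = r * dist x y"
    using assms by (auto simp: similitude_with_def)
  define h where "h = (\<lambda>x. (1 / r) *\<^sub>R (g x - g 0))"
  have "dist (h x) (h y) = dist x y" for x y
  proof -
    have "h x - h y = (1 / r) *\<^sub>R (g x - g y)"
      by (simp add: h_def scaleR_diff_right)
    then have "dist (h x) (h y) = (1 / r) * dist (g x) (g y)"
      using r by (simp add: dist_norm)
    also have "\<dots> = dist x y"
      using d r by simp
    finally show ?thesis .
  qed
  moreover have "h 0 = 0"
    by (simp add: h_def)
  ultimately have "orthogonal_transformation h"
    by (simp add: orthogonal_transformation_isometry)
  then have "bij h"
    by (rule orthogonal_transformation_bij)
  moreover have "bij (\<lambda>x. r *\<^sub>R x + g 0)"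
    by (rule bij_betw_byWitness[where f' = "\<lambda>x. (1 / r) *\<^sub>R (x - g 0)"]) (use r in auto)
  ultimately have "bij ((\<lambda>x. r *\<^sub>R x + g 0) \<circ> h)"
    by (rule bij_comp)
  moreover have "(\<lambda>x. r *\<^sub>R x + g 0) \<circ> h = g"
    by (rule ext) (use r in \<open>simp add: h_def\<close>)
  ultimately show ?thesis
    by simp
qed

lemma similitude_with_inv:
  fixes g :: "'a::euclidean_space \<Rightarrow> 'a"
  assumes "similitude_with r g"
  shows "similitude_with (1 / r) (inv g)"
proof -
  have r: "r > 0" and d: "\<And>x y. dist (g x) (g y) = r * dist x y"
    using assms by (auto simp: similitude_with_def)
  have "g (inv g x) = x" for x
    using bij_is_surj[OF similitude_with_bij[OF assms]] by (rule surj_f_inv_f)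
  then have "r * dist (inv g x) (inv g y) = dist x y" for x y
    using d[of "inv g x" "inv g y"] by metis
  then have "dist (inv g x) (inv g y) = 1 / r * dist x y" for x y
    using r by (simp add: field_simps)
  then show ?thesis
    using r unfolding similitude_with_def by simp
qed

lemma ball_subset_similitude_image:
  fixes g :: "'a::euclidean_space \<Rightarrow> 'a"
  assumes g: "similitude_with q g" and "\<rho> \<le> q * r"
  shows "ball (g c) \<rho> \<subseteq> g ` ball c r"
proof
  fix z assume z: "z \<in> ball (g c) \<rho>"
  obtain w where w: "z = g w"
    using bij_is_surj[OF similitude_with_bij[OF g]] by (rule surjE)
  then have "q * dist c w < q * r"
    using z assms similitude_with_dist[OF g, of c w] by simp
  moreover have "q > 0"
    using g by (simp add: similitude_with_def)
  ultimately show "z \<in> g ` ball c r"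
    using w by auto
qed

section \<open>Packing balls\<close>

text \<open>The volumes of the disjoint small balls add up to at most that of the large ball, and
  the volume of the unit ball cancels.\<close>

lemma card_disjoint_balls_le:
  fixes y :: "'i \<Rightarrow> 'a::euclidean_space"
  assumes I: "finite I" and "\<rho> > 0" "R > 0"
    and sub: "\<And>i. i \<in> I \<Longrightarrow> ball (y i) \<rho> \<subseteq> ball x R"
    and dj: "\<And>i j. i \<in> I \<Longrightarrow> j \<in> I \<Longrightarrow> i \<noteq> j \<Longrightarrow> ball (y i) \<rho> \<inter> ball (y j) \<rho> = {}"
  shows "real (card I) \<le> (R / \<rho>) ^ DIM('a)"
proof -
  define c where "c = unit_ball_vol (real DIM('a))"
  have c: "c > 0" by (simp add: c_def)
  have "real (card I) * (c * \<rho> ^ DIM('a)) = (\<Sum>i\<in>I. measure lebesgue (ball (y i) \<rho>))"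
    using assms by (simp add: content_ball c_def)
  also have "\<dots> = measure lebesgue (\<Union>i\<in>I. ball (y i) \<rho>)"
    by (rule measure_UNION'[symmetric])
      (use I dj in \<open>auto simp: pairwise_def disjnt_def\<close>)
  also have "\<dots> \<le> measure lebesgue (ball x R)"
    by (rule measure_mono_fmeasurable) (use I sub in auto)
  also have "\<dots> = c * R ^ DIM('a)"
    using assms by (simp add: content_ball c_def)
  finally have "real (card I) * \<rho> ^ DIM('a) \<le> R ^ DIM('a)"
    using c by (simp add: mult.left_commute)
  then show ?thesis
    using \<open>\<rho> > 0\<close> by (simp add: power_divide field_simps)
qed

section \<open>Paths and compositions\<close>

lemma path_map_simps [simp]:
  "path_map f [] = id" "path_map f (e # p) = f e \<circ> path_map f p"
  by (simp_all add: path_map_def)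

lemma path_map_append: "path_map f (p @ q) = path_map f p \<circ> path_map f q"
  by (induction p) (auto simp: fun_eq_iff)

lemma neg_path_map_snoc: "neg_path_map f (p @ [e]) = neg_path_map f p \<circ> inv (f e)"
  by (induction p) (auto simp: neg_path_map_def fun_eq_iff)

lemma path_prefix_0 [simp]: "path_prefix \<sigma> 0 = []"
  by (simp add: path_prefix_def)

lemma path_prefix_Suc: "path_prefix \<sigma> (Suc k) = path_prefix \<sigma> k @ [\<sigma> k]"
  by (simp add: path_prefix_def)

lemma length_path_prefix [simp]: "length (path_prefix \<sigma> k) = k"
  by (simp add: path_prefix_def)

lemma take_path_prefix: "m \<le> k \<Longrightarrow> take m (path_prefix \<sigma> k) = path_prefix \<sigma> m"
  by (simp add: path_prefix_def take_map)

text \<open>Used contrapositively: sequences that differ before position \<open>n\<close> have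
  incomparable cuts at all lengths from \<open>n\<close> on.\<close>

lemma prefix_path_prefix_take:
  assumes "prefix (path_prefix \<sigma> k) (path_prefix \<tau> l)" "n \<le> k"
  shows "path_prefix \<sigma> n = path_prefix \<tau> n"
proof -
  obtain r where r: "path_prefix \<tau> l = path_prefix \<sigma> k @ r"
    using assms by (auto elim: prefixE)
  then have "k \<le> l"
    using length_path_prefix[of \<tau> l] by simp
  then show ?thesis
    using arg_cong[OF r, of "take n"] \<open>n \<le> k\<close> by (simp add: take_path_prefix)
qed

lemma \<xi>_simps [simp]: "\<xi> a [] = 0" "\<xi> a (e # p) = a e + \<xi> a p" "\<xi> a (p @ q) = \<xi> a p + \<xi> a q"
  by (simp_all add: \<xi>_def)

definition prepend :: "'e list \<Rightarrow> (nat \<Rightarrow> 'e) \<Rightarrow> nat \<Rightarrow> 'e" where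
  "prepend p \<sigma> = foldr case_nat p \<sigma>"

lemma prepend_simps [simp]:
  "prepend [] \<sigma> = \<sigma>" "prepend (e # p) \<sigma> = case_nat e (prepend p \<sigma>)"
  by (simp_all add: prepend_def)

lemma path_prefix_case_nat: "path_prefix (case_nat e \<sigma>) (Suc k) = e # path_prefix \<sigma> k"
  by (rule nth_equalityI) (auto simp: path_prefix_def nth_Cons' simp del: upt_Suc split: nat.split)

lemma path_prefix_prepend: "path_prefix (prepend p \<sigma>) (length p) = p"
  by (induction p) (simp_all add: path_prefix_case_nat)

lemma case_nat_eq_iff: "case_nat x g = case_nat y h \<longleftrightarrow> x = y \<and> g = h"
proof
  assume "case_nat x g = case_nat y h"
  then have "case_nat x g n = case_nat y h n" for n
    by simp
  from this[of 0] this[of "Suc _"] show "x = y \<and> g = h"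
    by (simp add: fun_eq_iff)
qed simp

lemma inj_prepend: "inj (prepend p)"
  by (induction p) (auto simp: inj_def case_nat_eq_iff)

text \<open>Both words are initial segments of one sequence. Hence incomparable paths always produce
  distinct addresses.\<close>

lemma prepend_eq_imp_comparable:
  assumes "prepend p \<sigma> = prepend q \<tau>"
  shows "prefix p q \<or> prefix q p"
proof -
  have "p = path_prefix (prepend p \<sigma>) (length p)" "q = path_prefix (prepend p \<sigma>) (length q)"
    using path_prefix_prepend[of p \<sigma>] path_prefix_prepend[of q \<tau>, folded assms] by simp_all
  moreover have "prefix (path_prefix \<rho> m) (path_prefix \<rho> n)" if "m \<le> n" for \<rho> :: "nat \<Rightarrow> 'a" and m n
    using take_is_prefix take_path_prefix[OF that] by metis
  ultimately show ?thesis
    using nat_le_linear by metis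
qed

lemma finite_sequences_separated:
  fixes W :: "(nat \<Rightarrow> 'e) set"
  assumes "finite W"
  obtains n where "\<And>\<sigma> \<tau>. \<sigma> \<in> W \<Longrightarrow> \<tau> \<in> W \<Longrightarrow> \<sigma> \<noteq> \<tau> \<Longrightarrow> path_prefix \<sigma> n \<noteq> path_prefix \<tau> n"
proof -
  \<comment> \<open>\<open>d\<close> picks some position of disagreement for each pair. On the
    diagonal its value is arbitrary, which can only enlarge \<open>n\<close>.\<close>
  define d where "d = (\<lambda>\<sigma> \<tau>::nat \<Rightarrow> 'e. SOME i. \<sigma> i \<noteq> \<tau> i)"
  define n where "n = Suc (Max ((\<lambda>(\<sigma>, \<tau>). d \<sigma> \<tau>) ` (W \<times> W)))"
  show thesis
  proof
    fix \<sigma> \<tau> assume W: "\<sigma> \<in> W" "\<tau> \<in> W" "\<sigma> \<noteq> \<tau>"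
    then have "\<exists>i. \<sigma> i \<noteq> \<tau> i"
      by (simp add: fun_eq_iff)
    then have "\<sigma> (d \<sigma> \<tau>) \<noteq> \<tau> (d \<sigma> \<tau>)"
      unfolding d_def by (rule someI_ex)
    moreover have "d \<sigma> \<tau> \<in> (\<lambda>(\<sigma>, \<tau>). d \<sigma> \<tau>) ` (W \<times> W)"
      using W by force
    then have "d \<sigma> \<tau> < n"
      unfolding n_def using assms by (simp add: less_Suc_eq_le)
    ultimately show "path_prefix \<sigma> n \<noteq> path_prefix \<tau> n"
      by (auto simp: path_prefix_def)
  qed
qed

lemma inf_paths_reversal:
  "\<theta> \<in> inf_paths (reversal G) \<longleftrightarrow> (\<forall>i. \<theta> i \<in> arcs G \<and> tail G (\<theta> i) = head G (\<theta> (Suc i)))"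
  by (simp add: inf_paths_def reversal_def)

lemma awlast_snoc: "pre_digraph.awlast G u (p @ [e]) = head G e"
proof (induction p arbitrary: u)
  case (Cons b p)
  have "pre_digraph.awalk_verts G (head G b) (p @ [e]) \<noteq> []"
    by (cases p) (simp_all add: pre_digraph.awalk_verts.simps)
  with Cons show ?case
    by (simp add: pre_digraph.awalk_verts.simps)
qed (simp add: pre_digraph.awalk_verts.simps)

text \<open>The path condition in the reversed graph identifies the end of the cut with the
  \<open>G\<close>-head of the following edge. This form also covers the empty cut.\<close>

lemma prefix_end_reversal:
  assumes "\<theta> \<in> inf_paths (reversal G)"
  shows "prefix_end (reversal G) \<theta> k = head G (\<theta> k)"
proof (cases k)
  case 0
  then show ?thesis
    by (simp add: prefix_end_def pre_digraph.awalk_verts.simps reversal_def)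
next
  case (Suc m)
  then show ?thesis
    using assms awlast_snoc[of "reversal G"]
    by (auto simp: prefix_end_def path_prefix_Suc reversal_def inf_paths_def)
qed

lemma prepend_append: "prepend (p @ q) \<sigma> = prepend p (prepend q \<sigma>)"
  by (simp add: prepend_def)

lemma prepend_path_prefix: "prepend (path_prefix \<sigma> k) (\<lambda>i. \<sigma> (i + k)) = \<sigma>"
proof (induction k)
  case (Suc k)
  have "case_nat (\<sigma> k) (\<lambda>i. \<sigma> (i + Suc k)) = (\<lambda>i. \<sigma> (i + k))"
    by (auto simp: fun_eq_iff split: nat.split)
  with Suc show ?case
    by (simp add: path_prefix_Suc prepend_append)
qed simp

lemma \<xi>_path_prefix_mono: "k \<le> m \<Longrightarrow> \<xi> a (path_prefix \<sigma> k) \<le> \<xi> a (path_prefix \<sigma> m)"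
  by (rule lift_Suc_mono_le) (simp add: path_prefix_Suc)

text \<open>Removing the last edge of a proper extension of \<open>\<sigma>\<close> leaves all of
  \<open>\<sigma>\<close>, so the weight of what remains already exceeds \<open>l\<close>.\<close>

lemma stopping_paths_antichain:
  assumes "prefix \<sigma> \<tau>" "l < \<xi> a \<sigma>" "\<xi>_minus a \<tau> \<le> l"
  shows "\<sigma> = \<tau>"
proof (rule ccontr)
  assume "\<sigma> \<noteq> \<tau>"
  then obtain r where r: "\<tau> = \<sigma> @ r" "r \<noteq> []"
    using assms(1) by (auto elim: prefixE)
  then have "\<xi> a \<sigma> \<le> \<xi>_minus a \<tau>"
    by (simp add: \<xi>_minus_def \<xi>_def butlast_append)
  with assms show False
    by simp
qed

text \<open>In the opposite order, edges of a path in the reversed graph form a path in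
  \<open>G\<close>. It leads from the end of \<open>\<theta>|m\<close> back to the end of
  \<open>\<theta>|k\<close>.\<close>

definition backpath :: "(nat \<Rightarrow> 'e) \<Rightarrow> nat \<Rightarrow> nat \<Rightarrow> 'e list" where
  "backpath \<theta> k m = rev (map \<theta> [k..<m])"

lemma backpath_self [simp]: "backpath \<theta> k k = []"
  by (simp add: backpath_def)

lemma backpath_Suc: "k \<le> m \<Longrightarrow> backpath \<theta> k (Suc m) = \<theta> m # backpath \<theta> k m"
  by (simp add: backpath_def)

lemma butlast_backpath: "k < m \<Longrightarrow> butlast (backpath \<theta> k m) = backpath \<theta> (Suc k) m"
  by (simp add: backpath_def upt_conv_Cons)

lemma \<xi>_backpath: "k \<le> m \<Longrightarrow> \<xi> a (backpath \<theta> k m) + \<xi> a (path_prefix \<theta> k) = \<xi> a (path_prefix \<theta> m)"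
  by (induction m rule: dec_induct) (simp_all add: backpath_Suc path_prefix_Suc)

section \<open>Graph-directed iterated function systems\<close>

locale graph_IFS = fin_digraph G for G :: "('v, 'e) pre_digraph" +
  fixes f :: "'e \<Rightarrow> 'a::euclidean_space \<Rightarrow> 'a" and s :: real and a :: "'e \<Rightarrow> nat"
  assumes s_pos: "0 < s" and s_less_1: "s < 1"
    and a_pos: "e \<in> arcs G \<Longrightarrow> 1 \<le> a e"
    and f_similitude: "e \<in> arcs G \<Longrightarrow> similitude_with (s ^ a e) (f e)"
    and connected: "strongly_connected G"
    and arcs_nonempty: "arcs G \<noteq> {}"
    and OSC: "open_set_condition G f"
begin

lemma path_map_similitude:
  "set p \<subseteq> arcs G \<Longrightarrow> similitude_with (s ^ \<xi> a p) (path_map f p)"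
proof (induction p)
  case (Cons e p)
  then show ?case
    unfolding path_map_simps \<xi>_simps power_add
    by (intro similitude_with_comp f_similitude) auto
qed (simp add: similitude_with_id)

lemma path_map_bij: "set p \<subseteq> arcs G \<Longrightarrow> bij (path_map f p)"
  using path_map_similitude similitude_with_bij by blast

lemma length_le_\<xi>: "set p \<subseteq> arcs G \<Longrightarrow> length p \<le> \<xi> a p"
proof (induction p)
  case (Cons e p)
  then show ?case
    using a_pos[of e] by simp
qed simp

lemma awalk_path_prefix:
  assumes "\<sigma> \<in> inf_paths G"
  shows "awalk (tail G (\<sigma> 0)) (path_prefix \<sigma> k) (tail G (\<sigma> k))"
proof (induction k)
  case 0
  then show ?case
    using assms by (simp add: awalk_Nil_iff inf_paths_def)
next
  case (Suc k)
  moreover have "awalk (tail G (\<sigma> k)) [\<sigma> k] (tail G (\<sigma> (Suc k)))"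
    using assms by (simp add: awalk_simps inf_paths_def)
  ultimately show ?case
    unfolding path_prefix_Suc by (rule awalk_appendI)
qed

lemma path_prefix_subset_arcs: "\<sigma> \<in> inf_paths G \<Longrightarrow> set (path_prefix \<sigma> k) \<subseteq> arcs G"
  by (auto simp: path_prefix_def inf_paths_def)

lemma awalk_exists: "u \<in> verts G \<Longrightarrow> v \<in> verts G \<Longrightarrow> \<exists>p. awalk u p v"
  using connected by (simp add: strongly_connected_def flip: reachable_awalk)

lemma exists_inf_path:
  assumes "v \<in> verts G"
  obtains \<sigma> where "\<sigma> \<in> inf_paths G" "tail G (\<sigma> 0) = v"
proof -
  \<comment> \<open>A walk from \<open>u\<close> to the tail of some arc either begins with an arc
    leaving \<open>u\<close> or is empty, and then that arc itself leaves \<open>u\<close>.\<close>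
  have out: "\<exists>e\<in>arcs G. tail G e = u" if "u \<in> verts G" for u
  proof -
    obtain e where e: "e \<in> arcs G"
      using arcs_nonempty by blast
    from awalk_exists[OF that tail_in_verts[OF e]] obtain p where p: "awalk u p (tail G e)" ..
    show ?thesis
    proof (cases p)
      case Nil
      with p e show ?thesis
        by (auto simp: awalk_Nil_iff)
    next
      case (Cons d q)
      with p show ?thesis
        by (auto simp: awalk_Cons_iff)
    qed
  qed
  define next_arc where "next_arc = (\<lambda>u. SOME e. e \<in> arcs G \<and> tail G e = u)"
  have next_arc: "next_arc u \<in> arcs G" "tail G (next_arc u) = u" if "u \<in> verts G" for u
    using someI_ex[OF out[OF that, unfolded Bex_def]] by (simp_all add: next_arc_def)
  define \<sigma> where "\<sigma> = rec_nat (next_arc v) (\<lambda>_ e. next_arc (head G e))"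
  have \<sigma>: "\<sigma> 0 = next_arc v" "\<sigma> (Suc i) = next_arc (head G (\<sigma> i))" for i
    by (simp_all add: \<sigma>_def)
  have arcs: "\<sigma> i \<in> arcs G" for i
    by (induction i) (simp_all add: \<sigma> next_arc assms)
  show thesis
    by (rule that[of \<sigma>]) (simp_all add: inf_paths_def arcs \<sigma> next_arc assms)
qed

section \<open>Invariant ball and convergence of address points\<close>

lemma invariant_cball:
  obtains R where "R \<ge> 0" "\<And>e. e \<in> arcs G \<Longrightarrow> f e ` cball 0 R \<subseteq> cball 0 R"
proof
  \<comment> \<open>\<open>D\<close> bounds the displacement of 0 under every map. The radius solves
    \<open>D + s * R = R\<close>, and \<open>s\<close> bounds every contraction factor.\<close>
  define D where "D = (\<Sum>e\<in>arcs G. norm (f e 0))"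
  have D: "D \<ge> 0"
    by (simp add: D_def sum_nonneg)
  show "D / (1 - s) \<ge> 0"
    using D s_less_1 by simp
  fix e assume e: "e \<in> arcs G"
  show "f e ` cball 0 (D / (1 - s)) \<subseteq> cball 0 (D / (1 - s))"
  proof clarsimp
    fix x :: 'a assume x: "norm x \<le> D / (1 - s)"
    have "norm (f e x) \<le> norm (f e 0) + dist (f e x) (f e 0)"
      by (simp add: dist_norm norm_triangle_sub)
    also have "dist (f e x) (f e 0) = s ^ a e * norm x"
      using similitude_with_dist[OF f_similitude[OF e], of x 0] by simp
    also have "s ^ a e * norm x \<le> s * (D / (1 - s))"
      using power_decreasing[of 1 "a e" s] a_pos[OF e] s_pos s_less_1 x
      by (intro mult_mono) auto
    also have "norm (f e 0) \<le> D"
      unfolding D_def by (rule member_le_sum) (use e in auto)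
    also have "D + s * (D / (1 - s)) = D / (1 - s)"
      using s_less_1 by (simp add: field_simps)
    finally show "norm (f e x) \<le> D / (1 - s)"
      by simp
  qed
qed

definition R where
  "R = (SOME R. R \<ge> 0 \<and> (\<forall>e\<in>arcs G. f e ` cball 0 R \<subseteq> cball 0 R))"

lemma R_nonneg: "R \<ge> 0" and f_cball: "e \<in> arcs G \<Longrightarrow> f e ` cball 0 R \<subseteq> cball 0 R"
proof -
  have "\<exists>R. R \<ge> 0 \<and> (\<forall>e\<in>arcs G. f e ` cball 0 R \<subseteq> cball 0 R)"
    using invariant_cball by metis
  from someI_ex[OF this]
  show "R \<ge> 0" "e \<in> arcs G \<Longrightarrow> f e ` cball 0 R \<subseteq> cball 0 R"
    unfolding R_def by auto
qed

lemma path_map_cball: "set p \<subseteq> arcs G \<Longrightarrow> x \<in> cball 0 R \<Longrightarrow> path_map f p x \<in> cball 0 R"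
proof (induction p)
  case (Cons e p)
  then show ?case
    using f_cball[of e] by (simp only: list.set path_map_simps o_apply) blast
qed simp

text \<open>The later maps keep 0 inside the invariant ball, and the first \<open>m\<close> maps
  contract by at least \<open>s ^ m\<close> because every edge has weight at least 1. So the
  sequence is Cauchy, and \<open>lim\<close> is a genuine limit.\<close>

lemma address_point_tendsto:
  assumes \<sigma>: "\<sigma> \<in> inf_paths G"
  shows "(\<lambda>k. path_map f (path_prefix \<sigma> k) 0) \<longlonglongrightarrow> address_point f \<sigma>"
proof -
  have "Cauchy (\<lambda>k. path_map f (path_prefix \<sigma> k) 0)"
    unfolding Cauchy_altdef
  proof (intro allI impI)
    fix \<epsilon> :: real assume \<epsilon>: "\<epsilon> > 0"
    have "(\<lambda>n. s ^ n * R) \<longlonglongrightarrow> 0"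
      using s_pos s_less_1 by (auto intro!: tendsto_mult_left_zero LIMSEQ_power_zero)
    then have "eventually (\<lambda>n. s ^ n * R < \<epsilon>) sequentially"
      using \<epsilon> by (rule order_tendstoD)
    then obtain M where M: "\<And>n. n \<ge> M \<Longrightarrow> s ^ n * R < \<epsilon>"
      by (auto simp: eventually_sequentially)
    have "dist (path_map f (path_prefix \<sigma> m) 0) (path_map f (path_prefix \<sigma> n) 0) < \<epsilon>"
      if "m \<ge> M" "n > m" for m n
    proof -
      define y where "y = path_map f (map \<sigma> [m..<n]) 0"
      have "y \<in> cball 0 R"
        unfolding y_def using \<sigma> R_nonneg by (intro path_map_cball) (auto simp: inf_paths_def)
      moreover have "path_prefix \<sigma> n = path_prefix \<sigma> m @ map \<sigma> [m..<n]"
        using upt_add_eq_append[of 0 m "n - m"] \<open>n > m\<close> by (simp add: path_prefix_def)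
      then have "path_map f (path_prefix \<sigma> n) 0 = path_map f (path_prefix \<sigma> m) y"
        by (simp add: path_map_append y_def)
      moreover have "m \<le> \<xi> a (path_prefix \<sigma> m)"
        using length_le_\<xi>[OF path_prefix_subset_arcs[OF \<sigma>]] by (metis length_path_prefix)
      then have "s ^ \<xi> a (path_prefix \<sigma> m) \<le> s ^ m"
        using s_pos s_less_1 by (intro power_decreasing) auto
      ultimately have "dist (path_map f (path_prefix \<sigma> m) 0) (path_map f (path_prefix \<sigma> n) 0) \<le> s ^ m * R"
        using similitude_with_dist[OF path_map_similitude[OF path_prefix_subset_arcs[OF \<sigma>]], of m 0 y] s_pos
        by (simp add: mult_mono)
      with M[OF \<open>m \<ge> M\<close>] show ?thesis
        by simp
    qed
    then show "\<exists>M. \<forall>m\<ge>M. \<forall>n>m. dist (path_map f (path_prefix \<sigma> m) 0) (path_map f (path_prefix \<sigma> n) 0) < \<epsilon>"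
      by blast
  qed
  then show ?thesis
    unfolding address_point_def by (simp add: Cauchy_convergent_iff convergent_LIMSEQ_iff)
qed

lemma address_point_cball:
  assumes \<sigma>: "\<sigma> \<in> inf_paths G"
  shows "address_point f \<sigma> \<in> cball 0 R"
proof (rule closed_sequentially[OF closed_cball _ address_point_tendsto[OF \<sigma>]])
  show "path_map f (path_prefix \<sigma> k) 0 \<in> cball 0 R" for k
    using R_nonneg path_map_cball[OF path_prefix_subset_arcs[OF \<sigma>]] by simp
qed

lemma address_point_case_nat:
  assumes \<sigma>: "\<sigma> \<in> inf_paths G" and e: "e \<in> arcs G" "head G e = tail G (\<sigma> 0)"
  shows "case_nat e \<sigma> \<in> inf_paths G" "address_point f (case_nat e \<sigma>) = f e (address_point f \<sigma>)"
proof -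
  show 1: "case_nat e \<sigma> \<in> inf_paths G"
    using \<sigma> e by (auto simp: inf_paths_def split: nat.split)
  have "(\<lambda>k. dist (path_map f (path_prefix \<sigma> k) 0) (address_point f \<sigma>)) \<longlonglongrightarrow> 0"
    using address_point_tendsto[OF \<sigma>] by (simp flip: tendsto_dist_iff)
  then have "(\<lambda>k. s ^ a e * dist (path_map f (path_prefix \<sigma> k) 0) (address_point f \<sigma>)) \<longlonglongrightarrow> 0"
    by (rule tendsto_mult_right_zero)
  then have "(\<lambda>k. f e (path_map f (path_prefix \<sigma> k) 0)) \<longlonglongrightarrow> f e (address_point f \<sigma>)"
    by (subst tendsto_dist_iff) (simp add: similitude_with_dist[OF f_similitude[OF e(1)]])
  moreover have "(\<lambda>k. f e (path_map f (path_prefix \<sigma> k) 0)) \<longlonglongrightarrow> address_point f (case_nat e \<sigma>)"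
    using LIMSEQ_Suc[OF address_point_tendsto[OF 1]] by (simp add: path_prefix_case_nat)
  ultimately show "address_point f (case_nat e \<sigma>) = f e (address_point f \<sigma>)"
    using LIMSEQ_unique by blast
qed

lemma address_point_prepend:
  assumes "awalk u p (tail G (\<sigma> 0))" "\<sigma> \<in> inf_paths G"
  shows "prepend p \<sigma> \<in> inf_paths G \<and> tail G (prepend p \<sigma> 0) = u \<and>
    address_point f (prepend p \<sigma>) = path_map f p (address_point f \<sigma>)"
  using assms
proof (induction p arbitrary: u)
  case (Cons e p)
  from Cons.prems have e: "e \<in> arcs G" "u = tail G e" "awalk (head G e) p (tail G (\<sigma> 0))"
    by (simp_all add: awalk_Cons_iff)
  from Cons.IH[OF e(3)] Cons.prems have
    IH: "prepend p \<sigma> \<in> inf_paths G" "tail G (prepend p \<sigma> 0) = head G e"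
      "address_point f (prepend p \<sigma>) = path_map f p (address_point f \<sigma>)"
    by simp_all
  show ?case
    using address_point_case_nat[OF IH(1) e(1)] IH e by simp
qed (simp add: awalk_Nil_iff)

text \<open>Dropping the first \<open>k\<close> edges leaves an infinite path, whose point lies in
  the invariant ball.\<close>

lemma address_point_in_cylinder:
  assumes \<sigma>: "\<sigma> \<in> inf_paths G"
  shows "address_point f \<sigma> \<in> path_map f (path_prefix \<sigma> k) ` cball 0 R"
proof -
  let ?\<tau> = "\<lambda>i. \<sigma> (i + k)"
  have \<tau>: "?\<tau> \<in> inf_paths G"
    using \<sigma> by (simp add: inf_paths_def)
  have "address_point f \<sigma> = path_map f (path_prefix \<sigma> k) (address_point f ?\<tau>)"
    using address_point_prepend[of "tail G (\<sigma> 0)" "path_prefix \<sigma> k" ?\<tau>] awalk_path_prefix[OF \<sigma>] \<tau>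
    by (simp add: prepend_path_prefix)
  then show ?thesis
    using address_point_cball[OF \<tau>] by blast
qed

section \<open>The number of addresses of a point\<close>

definition addresses :: "'v \<Rightarrow> 'a \<Rightarrow> (nat \<Rightarrow> 'e) set" where
  "addresses v x = {\<sigma> \<in> inf_paths G. tail G (\<sigma> 0) = v \<and> address_point f \<sigma> = x}"

lemma attractor_iff_addresses: "x \<in> attractor G f v \<longleftrightarrow> addresses v x \<noteq> {}"
  by (auto simp: attractor_def addresses_def)

lemma prepend_addresses:
  "awalk u p v \<Longrightarrow> \<sigma> \<in> addresses v x \<Longrightarrow> prepend p \<sigma> \<in> addresses u (path_map f p x)"
  using address_point_prepend by (auto simp: addresses_def)

lemma path_map_attractor_subset:
  "awalk u p v \<Longrightarrow> path_map f p ` attractor G f v \<subseteq> attractor G f u"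
  using prepend_addresses by (force simp: attractor_iff_addresses)

text \<open>The paths branch at a first differing edge. There the open set condition separates the
  images, and the map of the common initial part is injective.\<close>

lemma open_images_disjoint:
  assumes sub: "\<And>e. e \<in> arcs G \<Longrightarrow> f e ` U (head G e) \<subseteq> U (tail G e)"
    and dj: "\<And>d e. d \<in> arcs G \<Longrightarrow> e \<in> arcs G \<Longrightarrow> d \<noteq> e \<Longrightarrow> tail G d = tail G e \<Longrightarrow>
      f e ` U (head G e) \<inter> f d ` U (head G d) = {}"
    and p: "awalk v p w" and q: "awalk v q w'" and "p \<parallel> q"
  shows "path_map f p ` U w \<inter> path_map f q ` U w' = {}"
proof -
  have path_sub: "path_map f r ` U y \<subseteq> U x" if "awalk x r y" for x r y
    using that
  proof (induction r arbitrary: x)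
    case (Cons e r)
    then have "f e ` path_map f r ` U y \<subseteq> f e ` U (head G e)" "e \<in> arcs G" "x = tail G e"
      by (auto simp: awalk_Cons_iff)
    then show ?case
      using sub[of e] by (simp add: image_comp)
  qed (simp add: awalk_Nil_iff)
  from parallel_decomp[OF \<open>p \<parallel> q\<close>] obtain r b p' c q' where
    bc: "b \<noteq> c" and pq: "p = r @ b # p'" "q = r @ c # q'"
    by blast
  have b: "b \<in> arcs G" "awalk (head G b) p' w" and c: "c \<in> arcs G" "awalk (head G c) q' w'"
    and r: "set r \<subseteq> arcs G" and "tail G b = tail G c"
    using p q unfolding pq by (auto simp: awalk_Cons_iff)
  then have "f b ` U (head G b) \<inter> f c ` U (head G c) = {}"
    using dj[of c b] bc by auto
  then have "f b ` path_map f p' ` U w \<inter> f c ` path_map f q' ` U w' = {}"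
    using path_sub[OF b(2)] path_sub[OF c(2)] by blast
  moreover have "inj (path_map f r)"
    using path_map_bij[OF r] by (rule bij_is_inj)
  ultimately have "path_map f r ` (f b ` path_map f p' ` U w) \<inter> path_map f r ` (f c ` path_map f q' ` U w') = {}"
    by (simp flip: image_Int)
  then show ?thesis
    by (simp add: pq path_map_append image_comp o_assoc)
qed

text \<open>
  Distinct addresses of \<open>x\<close>, cut where \<open>\<xi>\<close> first exceeds a large \<open>l\<close>, give disjoint open sets that
  lie within distance \<open>O(s\<^sup>l)\<close> of \<open>x\<close> and contain balls of radius comparable to \<open>s\<^sup>l\<close>.
\<close>

lemma addresses_bounded:
  obtains B where "\<And>v x W. finite W \<Longrightarrow> W \<subseteq> addresses v x \<Longrightarrow> real (card W) \<le> B"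
proof -
  obtain U :: "'v \<Rightarrow> 'a set" where
    osc: "\<forall>v\<in>verts G. U v \<noteq> {} \<and> bounded (U v) \<and> open (U v)"
      "\<forall>e\<in>arcs G. f e ` U (head G e) \<subseteq> U (tail G e)"
      "\<forall>e\<in>arcs G. \<forall>d\<in>arcs G. d \<noteq> e \<and> tail G d = tail G e \<longrightarrow>
         f e ` U (head G e) \<inter> f d ` U (head G d) = {}"
    using OSC unfolding open_set_condition_def by (elim exE conjE)
  have U: "U v \<noteq> {}" "open (U v)" if "v \<in> verts G" for v
    using osc(1) that by auto
  have sub: "f e ` U (head G e) \<subseteq> U (tail G e)" if "e \<in> arcs G" for e
    using osc(2) that by (rule bspec)
  have dj: "f e ` U (head G e) \<inter> f d ` U (head G d) = {}"
    if "d \<in> arcs G" "e \<in> arcs G" "d \<noteq> e" "tail G d = tail G e" for d e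
    using osc(3)[rule_format, of e d] that by simp
  have "\<exists>c r. r > 0 \<and> ball c r \<subseteq> U v" if "v \<in> verts G" for v
    using U[OF that] by (meson ex_in_conv openE)
  then obtain c r' where cr: "\<And>v. v \<in> verts G \<Longrightarrow> r' v > 0 \<and> ball (c v) (r' v) \<subseteq> U v"
    by metis
  define r where "r = Min (insert 1 (r' ` verts G))"
  have r: "r > 0"
    using cr by (simp add: r_def)
  have ball_U: "ball (c v) r \<subseteq> U v" if "v \<in> verts G" for v
  proof -
    have "r \<le> r' v"
      unfolding r_def using that by (intro Min_le) auto
    then show ?thesis
      using cr[OF that] subset_ball by blast
  qed
  \<comment> \<open>\<open>D\<close> bounds the norm of every point of the invariant ball and of
    every chosen centre.\<close>
  define D where "D = R + (\<Sum>v\<in>verts G. norm (c v))"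
  have norm_c: "norm (c v) \<le> D" if "v \<in> verts G" for v
    using member_le_sum[of v "verts G" "\<lambda>v. norm (c v)"] that R_nonneg by (simp add: D_def)
  have D: "R \<le> D" "0 \<le> D"
    using R_nonneg by (auto simp: D_def sum_nonneg)
  \<comment> \<open>\<open>m\<close> bounds all edge weights, so a cut made when the weight first
    exceeds \<open>l\<close> has weight at most \<open>l + m\<close>.\<close>
  define m where "m = (\<Sum>e\<in>arcs G. a e)"
  have m: "a e \<le> m" if "e \<in> arcs G" for e
    unfolding m_def using that by (intro member_le_sum) auto
  have \<xi>_le: "\<xi> a (path_prefix \<sigma> k) \<le> m * k" if "\<sigma> \<in> inf_paths G" for \<sigma> k
  proof (induction k)
    case (Suc k)
    then show ?case
      using m[of "\<sigma> k"] that by (simp add: path_prefix_Suc inf_paths_def add_mono)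
  qed simp
  show thesis
  proof
    fix v x and W :: "(nat \<Rightarrow> 'e) set"
    assume W: "finite W" "W \<subseteq> addresses v x"
    from finite_sequences_separated[OF W(1)] obtain n where
      n: "\<And>\<sigma> \<tau>. \<sigma> \<in> W \<Longrightarrow> \<tau> \<in> W \<Longrightarrow> \<sigma> \<noteq> \<tau> \<Longrightarrow> path_prefix \<sigma> n \<noteq> path_prefix \<tau> n"
      by blast
    \<comment> \<open>A path of weight above \<open>m * n\<close> has more than \<open>n\<close>
      edges, so the cuts of distinct members of \<open>W\<close> are incomparable.\<close>
    define l where "l = m * n"
    define \<kappa> where "\<kappa> = (\<lambda>\<sigma>. LEAST k. l < \<xi> a (path_prefix \<sigma> k))"
    define p where "p = (\<lambda>\<sigma>. path_prefix \<sigma> (\<kappa> \<sigma>))"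
    define w where "w = (\<lambda>\<sigma>. tail G (\<sigma> (\<kappa> \<sigma>)))"
    define y where "y = (\<lambda>\<sigma>. path_map f (p \<sigma>) (c (w \<sigma>)))"
    \<comment> \<open>The smallest scaling factor that a cut can have, so that one radius serves all
      of \<open>W\<close>.\<close>
    define \<rho> where "\<rho> = s ^ (l + m) * r"
    have \<sigma>: "\<sigma> \<in> inf_paths G" "tail G (\<sigma> 0) = v" "address_point f \<sigma> = x" if "\<sigma> \<in> W" for \<sigma>
      using W(2) that by (auto simp: addresses_def)
    have p: "awalk v (p \<sigma>) (w \<sigma>)" "set (p \<sigma>) \<subseteq> arcs G" "w \<sigma> \<in> verts G" if "\<sigma> \<in> W" for \<sigma>
      using awalk_path_prefix[OF \<sigma>(1)[OF that], of "\<kappa> \<sigma>"] \<sigma>[OF that]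
      by (auto simp: p_def w_def)
    have \<xi>_p: "l < \<xi> a (p \<sigma>)" "\<xi> a (p \<sigma>) \<le> l + m" "n \<le> \<kappa> \<sigma>" if "\<sigma> \<in> W" for \<sigma>
    proof -
      have "Suc l \<le> \<xi> a (path_prefix \<sigma> (Suc l))"
        using length_le_\<xi>[OF path_prefix_subset_arcs[OF \<sigma>(1)[OF that]]] by (metis length_path_prefix)
      then have "l < \<xi> a (path_prefix \<sigma> (Suc l))"
        by simp
      then show l: "l < \<xi> a (p \<sigma>)"
        unfolding p_def \<kappa>_def by (rule LeastI)
      then obtain j where j: "\<kappa> \<sigma> = Suc j"
        unfolding p_def by (cases "\<kappa> \<sigma>") auto
      then have "\<not> l < \<xi> a (path_prefix \<sigma> j)"
        unfolding \<kappa>_def by (intro not_less_Least) simp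
      then show "\<xi> a (p \<sigma>) \<le> l + m"
        using m[of "\<sigma> j"] \<sigma>(1)[OF that] by (auto simp: p_def j path_prefix_Suc inf_paths_def)
      have "m * n < m * \<kappa> \<sigma>"
        using l \<xi>_le[OF \<sigma>(1)[OF that], of "\<kappa> \<sigma>"] unfolding l_def p_def by linarith
      then show "n \<le> \<kappa> \<sigma>"
        by simp
    qed
    have scale: "s ^ (l + m) \<le> s ^ \<xi> a (p \<sigma>)" "s ^ \<xi> a (p \<sigma>) \<le> s ^ l" if "\<sigma> \<in> W" for \<sigma>
      using \<xi>_p[OF that] s_pos s_less_1 by (auto intro!: power_decreasing)
    have \<rho>: "\<rho> > 0" "\<rho> \<le> s ^ l * r"
      using r s_pos s_less_1 power_decreasing[of l "l + m" s] by (auto simp: \<rho>_def)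
    have ball_y: "ball (y \<sigma>) \<rho> \<subseteq> path_map f (p \<sigma>) ` U (w \<sigma>)" if "\<sigma> \<in> W" for \<sigma>
    proof -
      have "\<rho> \<le> s ^ \<xi> a (p \<sigma>) * r"
        unfolding \<rho>_def using scale[OF that] r by (intro mult_right_mono) auto
      then have "ball (y \<sigma>) \<rho> \<subseteq> path_map f (p \<sigma>) ` ball (c (w \<sigma>)) r"
        unfolding y_def using ball_subset_similitude_image path_map_similitude[OF p(2)[OF that]] by blast
      then show ?thesis
        using ball_U[OF p(3)[OF that]] by blast
    qed
    have "real (card W) \<le> (s ^ l * (2 * D + r) / \<rho>) ^ DIM('a)"
    proof (rule card_disjoint_balls_le[where y = y and x = x])
      show "0 < s ^ l * (2 * D + r)"
        using s_pos D r by simp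
      fix \<sigma> assume "\<sigma> \<in> W"
      from address_point_in_cylinder[OF \<sigma>(1)[OF this], of "\<kappa> \<sigma>"] obtain z where
        z: "norm z \<le> R" "x = path_map f (p \<sigma>) z"
        using \<sigma>(3)[OF \<open>\<sigma> \<in> W\<close>] by (auto simp: p_def)
      have "dist x (y \<sigma>) = s ^ \<xi> a (p \<sigma>) * dist z (c (w \<sigma>))"
        unfolding y_def z(2) by (rule similitude_with_dist[OF path_map_similitude[OF p(2)[OF \<open>\<sigma> \<in> W\<close>]]])
      also have "\<dots> \<le> s ^ l * (2 * D)"
      proof (rule mult_mono[OF scale(2)[OF \<open>\<sigma> \<in> W\<close>]])
        show "dist z (c (w \<sigma>)) \<le> 2 * D"
          using norm_triangle_ineq4[of z "c (w \<sigma>)"] norm_c[OF p(3)[OF \<open>\<sigma> \<in> W\<close>]] z(1) D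
          by (simp add: dist_norm)
      qed (use s_pos in auto)
      finally have d: "dist x (y \<sigma>) \<le> s ^ l * (2 * D)" .
      show "ball (y \<sigma>) \<rho> \<subseteq> ball x (s ^ l * (2 * D + r))"
      proof
        fix u assume "u \<in> ball (y \<sigma>) \<rho>"
        then show "u \<in> ball x (s ^ l * (2 * D + r))"
          using d \<rho>(2) dist_triangle[of x u "y \<sigma>"] by (simp add: distrib_left)
      qed
    next
      fix \<sigma> \<tau> assume W': "\<sigma> \<in> W" "\<tau> \<in> W" "\<sigma> \<noteq> \<tau>"
      then have "p \<sigma> \<parallel> p \<tau>"
        using n[OF W'] prefix_path_prefix_take[OF _ \<xi>_p(3)[OF W'(1)], where \<tau> = \<tau> and l = "\<kappa> \<tau>"]
          prefix_path_prefix_take[OF _ \<xi>_p(3)[OF W'(2)], where \<tau> = \<sigma> and l = "\<kappa> \<sigma>"]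
        by (auto simp: p_def parallel_def)
      with sub dj p(1)[OF W'(1)] p(1)[OF W'(2)]
      have "path_map f (p \<sigma>) ` U (w \<sigma>) \<inter> path_map f (p \<tau>) ` U (w \<tau>) = {}"
        by (rule open_images_disjoint)
      then show "ball (y \<sigma>) \<rho> \<inter> ball (y \<tau>) \<rho> = {}"
        using ball_y[OF W'(1)] ball_y[OF W'(2)] by blast
    qed (rule W(1), rule \<rho>(1))
    \<comment> \<open>The factor \<open>s ^ l\<close> cancels, so the bound depends neither on
      \<open>l\<close> nor on \<open>W\<close>.\<close>
    also have "s ^ l * (2 * D + r) / \<rho> = (2 * D + r) / (s ^ m * r)"
      using s_pos by (simp add: \<rho>_def power_add)
    finally show "real (card W) \<le> ((2 * D + r) / (s ^ m * r)) ^ DIM('a)" .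
  qed
qed

text \<open>
  If the conclusion failed, every point \<open>x\<close> of \<open>A\<^sub>u\<close> with \<open>n\<close> addresses would give the point
  \<open>f\<^sub>\<tau>(x)\<close> of \<open>A\<^sub>v\<close> at least \<open>n + 1\<close> addresses: \<open>n\<close> through \<open>\<tau>\<close> and one through \<open>\<sigma>\<close>. Going back
  from \<open>v\<close> to \<open>u\<close> and iterating contradicts the bound on the number of addresses.
\<close>

lemma attractor_image_subset_imp_comparable:
  assumes \<tau>: "awalk v \<tau> u" and \<sigma>: "awalk v \<sigma> u'"
    and subset: "path_map f \<tau> ` attractor G f u \<subseteq> path_map f \<sigma> ` attractor G f u'"
  shows "prefix \<tau> \<sigma> \<or> prefix \<sigma> \<tau>"
proof (rule ccontr)
  assume incomparable: "\<not> (prefix \<tau> \<sigma> \<or> prefix \<sigma> \<tau>)"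
  have uv: "u \<in> verts G" "v \<in> verts G"
    using \<tau> awlast_of_awalk[OF \<tau>] awlast_in_verts[of v \<tau>] by (auto simp: awalk_def)
  \<comment> \<open>The return path brings the enlarged address set back to the vertex
    \<open>u\<close>, so that the induction can continue.\<close>
  then obtain \<kappa> where \<kappa>: "awalk u \<kappa> v"
    using connected unfolding strongly_connected_def reachable_awalk by blast
  \<comment> \<open>Starting from one address rather than none guarantees that \<open>x\<close> lies
    in the attractor at \<open>u\<close>, where the inclusion applies.\<close>
  have "\<exists>x W. finite W \<and> card W = Suc n \<and> W \<subseteq> addresses u x" for n
  proof (induction n)
    case 0
    obtain \<omega> where "\<omega> \<in> inf_paths G" "tail G (\<omega> 0) = u"
      using exists_inf_path[OF uv(1)] .
    then show ?case
      by (intro exI[of _ "address_point f \<omega>"] exI[of _ "{\<omega>}"]) (simp add: addresses_def)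
  next
    case (Suc n)
    then obtain x W where W: "finite W" "card W = Suc n" "W \<subseteq> addresses u x"
      by blast
    then have "x \<in> attractor G f u"
      by (force simp: attractor_iff_addresses)
    with subset obtain y where y: "y \<in> attractor G f u'" "path_map f \<tau> x = path_map f \<sigma> y"
      by blast
    then obtain \<omega> where \<omega>: "\<omega> \<in> addresses u' y"
      by (auto simp: attractor_iff_addresses)
    define W' where "W' = prepend \<kappa> ` insert (prepend \<sigma> \<omega>) (prepend \<tau> ` W)"
    have "prepend \<sigma> \<omega> \<notin> prepend \<tau> ` W"
      using incomparable prepend_eq_imp_comparable by blast
    moreover have "card (prepend \<tau> ` W) = Suc n"
      using card_image[OF inj_on_subset[OF inj_prepend]] W(2) by (metis subset_UNIV)
    ultimately have "card (insert (prepend \<sigma> \<omega>) (prepend \<tau> ` W)) = Suc (Suc n)"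
      using W(1) by simp
    then have "card W' = Suc (Suc n)"
      unfolding W'_def using card_image[OF inj_on_subset[OF inj_prepend]] by (metis subset_UNIV)
    moreover have "W' \<subseteq> addresses u (path_map f \<kappa> (path_map f \<tau> x))"
    proof -
      have "prepend \<sigma> \<omega> \<in> addresses v (path_map f \<tau> x)"
        using prepend_addresses[OF \<sigma> \<omega>] y(2) by simp
      moreover have "prepend \<tau> ` W \<subseteq> addresses v (path_map f \<tau> x)"
        using prepend_addresses[OF \<tau>] W(3) by blast
      ultimately show ?thesis
        unfolding W'_def using prepend_addresses[OF \<kappa>] by blast
    qed
    moreover have "finite W'"
      using W(1) by (simp add: W'_def)
    ultimately show ?case
      by blast
  qed
  moreover obtain B where B: "\<And>v x W. finite W \<Longrightarrow> W \<subseteq> addresses v x \<Longrightarrow> real (card W) \<le> B"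
    using addresses_bounded by blast
  ultimately have "real (Suc n) \<le> B" for n
    by metis
  then show False
    by (metis real_arch_simple not_less_eq_eq of_nat_le_iff order_trans order_refl)
qed

section \<open>Central tiles\<close>

context
  fixes \<theta> assumes \<theta>: "\<theta> \<in> inf_paths (reversal G)"
begin

lemma reversal_arcs: "\<theta> i \<in> arcs G" and reversal_tail: "tail G (\<theta> i) = head G (\<theta> (Suc i))"
  using \<theta> by (simp_all add: inf_paths_reversal)

lemma awalk_backpath: "k \<le> m \<Longrightarrow> awalk (head G (\<theta> m)) (backpath \<theta> k m) (head G (\<theta> k))"
  by (induction m rule: dec_induct)
    (simp_all add: awalk_simps backpath_Suc reversal_arcs flip: reversal_tail)

lemma neg_path_map_bij: "bij (neg_path_map f (path_prefix \<theta> k))"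
proof (induction k)
  case (Suc k)
  have "bij (inv (f (\<theta> k)))"
    using similitude_with_bij[OF f_similitude[OF reversal_arcs]] by (rule bij_imp_bij_inv)
  then show ?case
    unfolding path_prefix_Suc neg_path_map_snoc using Suc by (rule bij_comp)
qed (simp add: neg_path_map_def flip: id_def)

lemma neg_path_map_Suc_comp:
  "neg_path_map f (path_prefix \<theta> (Suc k)) \<circ> f (\<theta> k) = neg_path_map f (path_prefix \<theta> k)"
proof -
  have "inj (f (\<theta> k))"
    using similitude_with_bij[OF f_similitude[OF reversal_arcs]] by (rule bij_is_inj)
  then show ?thesis
    unfolding path_prefix_Suc neg_path_map_snoc comp_assoc by simp
qed

text \<open>Read backwards, the edges cancel the innermost inverses one at a time.\<close>

lemma neg_path_map_backpath:
  "k \<le> m \<Longrightarrow>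
    neg_path_map f (path_prefix \<theta> m) \<circ> path_map f (backpath \<theta> k m) = neg_path_map f (path_prefix \<theta> k)"
proof (induction m rule: dec_induct)
  case (step m)
  then show ?case
    by (simp only: backpath_Suc path_map_simps neg_path_map_Suc_comp flip: comp_assoc)
qed simp

lemma neg_path_map_similitude: "similitude (neg_path_map f (path_prefix \<theta> k))"
proof (induction k)
  case (Suc k)
  then show ?case
    unfolding path_prefix_Suc neg_path_map_snoc similitude_def
    using similitude_with_comp similitude_with_inv[OF f_similitude[OF reversal_arcs]] by blast
next
  case 0
  show ?case
    using similitude_with_id by (simp add: similitude_def neg_path_map_def flip: id_def) blast
qed

end

section \<open>Supertiles and the central tiles among them\<close>

definition central_tile :: "(nat \<Rightarrow> 'e) \<Rightarrow> nat \<Rightarrow> 'a set" where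
  "central_tile \<theta> k = neg_path_map f (path_prefix \<theta> k) ` attractor G f (head G (\<theta> k))"

text \<open>The deflated tiling \<open>\<alpha>\<^sup>K(\<Pi>(\<theta>))\<close>, before rescaling by \<open>s\<^sup>K\<close>.\<close>

definition supertiles :: "nat \<Rightarrow> (nat \<Rightarrow> 'e) \<Rightarrow> 'a set set" where
  "supertiles K \<theta> = {neg_path_map f (path_prefix \<theta> k) ` path_map f \<sigma> ` attractor G f w | k \<sigma> w.
     K \<le> \<xi> a (path_prefix \<theta> k) \<and> awalk (head G (\<theta> k)) \<sigma> w \<and>
     \<xi>_minus a \<sigma> \<le> \<xi> a (path_prefix \<theta> k) - K \<and> \<xi> a (path_prefix \<theta> k) - K < \<xi> a \<sigma>}"

text \<open>The rescaling built into the canonical tiling is undone, which leaves images of unscaled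
  tiles.\<close>

lemma canonical_tiling_rescaled:
  "map_tiles (g \<circ> (\<lambda>x. s ^ k *\<^sub>R x)) (canonical_tiling G f s a v k) =
    {g ` path_map f \<sigma> ` attractor G f w | \<sigma> w. awalk v \<sigma> w \<and> \<xi>_minus a \<sigma> \<le> k \<and> k < \<xi> a \<sigma>}"
proof -
  have "(g \<circ> (\<lambda>x. s ^ k *\<^sub>R x)) ` (\<lambda>x. inverse (s ^ k) *\<^sub>R x) ` t = g ` t" for t :: "'a set"
    using s_pos by (simp add: image_image)
  then have "map_tiles (g \<circ> (\<lambda>x. s ^ k *\<^sub>R x)) (canonical_tiling G f s a v k) =
      (\<lambda>t. g ` t) ` {tile G f v \<sigma> | \<sigma>. \<sigma> \<in> \<Omega> G a v k}"
    unfolding canonical_tiling_def map_tiles_def image_image by metis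
  also have "{tile G f v \<sigma> | \<sigma>. \<sigma> \<in> \<Omega> G a v k} =
      {path_map f \<sigma> ` attractor G f w | \<sigma> w. awalk v \<sigma> w \<and> \<xi>_minus a \<sigma> \<le> k \<and> k < \<xi> a \<sigma>}"
    unfolding tile_def \<Omega>_def by (auto dest: awlast_of_awalk)
  also have "(\<lambda>t. g ` t) ` \<dots> = {g ` path_map f \<sigma> ` attractor G f w | \<sigma> w.
      awalk v \<sigma> w \<and> \<xi>_minus a \<sigma> \<le> k \<and> k < \<xi> a \<sigma>}"
    by blast
  finally show ?thesis .
qed

lemma deflation_eq_supertiles:
  assumes \<theta>: "\<theta> \<in> inf_paths (reversal G)"
  shows "deflation G f s a K E \<theta> = (\<lambda>t. (\<lambda>x. s ^ K *\<^sub>R x) ` E ` t) ` supertiles K \<theta>"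
proof -
  have "deflation G f s a K E \<theta> = (\<Union>k\<in>{k. K \<le> \<xi> a (path_prefix \<theta> k)}.
      {((\<lambda>x. s ^ K *\<^sub>R x) \<circ> E \<circ> neg_path_map f (path_prefix \<theta> k)) ` path_map f \<sigma> ` attractor G f w | \<sigma> w.
        awalk (head G (\<theta> k)) \<sigma> w \<and> \<xi>_minus a \<sigma> \<le> \<xi> a (path_prefix \<theta> k) - K \<and>
        \<xi> a (path_prefix \<theta> k) - K < \<xi> a \<sigma>})"
    unfolding deflation_def prefix_end_reversal[OF \<theta>] canonical_tiling_rescaled ..
  also have "\<dots> = (\<lambda>t. (\<lambda>x. s ^ K *\<^sub>R x) ` E ` t) ` supertiles K \<theta>"
    unfolding supertiles_def image_comp[symmetric] by blast
  finally show ?thesis .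
qed

text \<open>Scaling by \<open>s ^ K\<close> is injective on sets, so it can be removed from both
  sides.\<close>

lemma supertiles_eq_of_deflation_eq:
  assumes "\<theta> \<in> inf_paths (reversal G)" "\<psi> \<in> inf_paths (reversal G)"
    and eq: "deflation G f s a K id \<theta> = deflation G f s a K E \<psi>"
  shows "supertiles K \<theta> = (\<lambda>t. E ` t) ` supertiles K \<psi>"
proof -
  have "inj (\<lambda>x::'a. s ^ K *\<^sub>R x)"
    using s_pos by (auto simp: inj_def)
  then have "inj ((`) (\<lambda>x::'a. s ^ K *\<^sub>R x))"
    by (rule inj_image_eq_iff[THEN iffD1, THEN injI])
  moreover have "(`) (\<lambda>x. s ^ K *\<^sub>R x) ` supertiles K \<theta> =
      (`) (\<lambda>x. s ^ K *\<^sub>R x) ` (\<lambda>t. E ` t) ` supertiles K \<psi>"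
    using eq unfolding assms(1,2)[THEN deflation_eq_supertiles] by (simp add: image_comp comp_def)
  ultimately show ?thesis
    by (simp add: inj_image_eq_iff)
qed

text \<open>Seen from the cut at \<open>k + 1\<close>, the central tile is the tile of the one-edge
  path \<open>[\<theta> k]\<close>. The bounds on \<open>K\<close> say exactly that this path is a
  stopping path.\<close>

lemma central_tile_in_supertiles:
  assumes \<theta>: "\<theta> \<in> inf_paths (reversal G)"
    and K: "\<xi> a (path_prefix \<theta> k) < K" "K \<le> \<xi> a (path_prefix \<theta> (Suc k))"
  shows "central_tile \<theta> k \<in> supertiles K \<theta>"
proof -
  have "central_tile \<theta> k =
      neg_path_map f (path_prefix \<theta> (Suc k)) ` path_map f [\<theta> k] ` attractor G f (head G (\<theta> k))"
    using neg_path_map_Suc_comp[OF \<theta>, of k] by (simp add: central_tile_def image_comp)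
  moreover have "awalk (head G (\<theta> (Suc k))) [\<theta> k] (head G (\<theta> k))"
    using awalk_backpath[OF \<theta>, of k "Suc k"] by (simp add: backpath_Suc)
  moreover have "\<xi>_minus a [\<theta> k] \<le> \<xi> a (path_prefix \<theta> (Suc k)) - K"
      "\<xi> a (path_prefix \<theta> (Suc k)) - K < \<xi> a [\<theta> k]"
    using K by (auto simp: \<xi>_minus_def path_prefix_Suc)
  ultimately show ?thesis
    unfolding supertiles_def using K(2) by blast
qed

text \<open>The map of the smaller cut factors through that of the larger one by a path of
  \<open>G\<close>, and path maps send attractors into attractors.\<close>

lemma central_tile_mono:
  assumes \<theta>: "\<theta> \<in> inf_paths (reversal G)" and "k \<le> m"
  shows "central_tile \<theta> k \<subseteq> central_tile \<theta> m"
  unfolding central_tile_def neg_path_map_backpath[OF assms, symmetric] image_comp[symmetric]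
  by (intro image_mono path_map_attractor_subset awalk_backpath assms)

text \<open>
  The image of the first central tile of \<open>\<psi>\<close> lies in some central tile \<open>C\<close> of \<open>\<theta>\<close>. At the level
  of \<open>C\<close>, the images of the central tiles of \<open>\<psi>\<close> are tiles of the same tiling as \<open>C\<close> and contain
  that image as well, so one of them equals \<open>C\<close>.
\<close>

lemma central_tiles_coincide:
  assumes \<theta>: "\<theta> \<in> inf_paths (reversal G)" and \<psi>: "\<psi> \<in> inf_paths (reversal G)"
    and eq: "\<And>K. 1 \<le> K \<Longrightarrow> supertiles K \<theta> = (\<lambda>t. E ` t) ` supertiles K \<psi>"
  obtains k j where "E ` central_tile \<psi> j = central_tile \<theta> k"
proof -
  have "central_tile \<psi> 0 \<in> supertiles 1 \<psi>"
    using a_pos[OF reversal_arcs[OF \<psi>]]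
    by (intro central_tile_in_supertiles[OF \<psi>]) (auto simp: path_prefix_Suc)
  then have "E ` central_tile \<psi> 0 \<in> supertiles 1 \<theta>"
    using eq[of 1] by blast
  then obtain k \<sigma>\<^sub>0 w\<^sub>0 where \<sigma>\<^sub>0: "awalk (head G (\<theta> k)) \<sigma>\<^sub>0 w\<^sub>0"
    and E0: "E ` central_tile \<psi> 0 =
      neg_path_map f (path_prefix \<theta> k) ` path_map f \<sigma>\<^sub>0 ` attractor G f w\<^sub>0"
    unfolding supertiles_def by blast
  \<comment> \<open>The lowest level at which the central tile \<open>k\<close> of
    \<open>\<theta>\<close> is a supertile.\<close>
  define K where "K = Suc (\<xi> a (path_prefix \<theta> k))"
  have "K \<le> \<xi> a (path_prefix \<psi> K)"
    using length_le_\<xi>[of "path_prefix \<psi> K"] reversal_arcs[OF \<psi>] by (auto simp: path_prefix_def)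
  \<comment> \<open>The first cut of \<open>\<psi>\<close> of weight at least \<open>K\<close>. It
    is nonempty since \<open>K > 0\<close>, and the central tile just before it is a supertile at
    level \<open>K\<close>.\<close>
  moreover define n where "n = (LEAST n. K \<le> \<xi> a (path_prefix \<psi> n))"
  ultimately have n: "K \<le> \<xi> a (path_prefix \<psi> n)"
    by (metis LeastI)
  then obtain j where j: "n = Suc j"
    by (cases n) (auto simp: K_def)
  then have "\<xi> a (path_prefix \<psi> j) < K"
    using not_less_Least[of j "\<lambda>n. K \<le> \<xi> a (path_prefix \<psi> n)"] by (simp add: n_def)
  then have "central_tile \<psi> j \<in> supertiles K \<psi>"
    using n j central_tile_in_supertiles[OF \<psi>] by blast
  then have "E ` central_tile \<psi> j \<in> supertiles K \<theta>"
    using eq[of K] by (auto simp: K_def)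
  then obtain m \<sigma> w where m: "K \<le> \<xi> a (path_prefix \<theta> m)" and \<sigma>: "awalk (head G (\<theta> m)) \<sigma> w"
    and \<sigma>_bounds: "\<xi>_minus a \<sigma> \<le> \<xi> a (path_prefix \<theta> m) - K" "\<xi> a (path_prefix \<theta> m) - K < \<xi> a \<sigma>"
    and Ej: "E ` central_tile \<psi> j =
      neg_path_map f (path_prefix \<theta> m) ` path_map f \<sigma> ` attractor G f w"
    unfolding supertiles_def by blast
  have km: "k < m"
  proof (rule ccontr)
    assume "\<not> k < m"
    then have "\<xi> a (path_prefix \<theta> m) \<le> \<xi> a (path_prefix \<theta> k)"
      by (intro \<xi>_path_prefix_mono) simp
    with m show False
      by (simp add: K_def)
  qed
  \<comment> \<open>The path that addresses the central tile \<open>k\<close> from the cut at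
    \<open>m\<close>, where \<open>\<sigma>\<close> addresses the image of the central tile
    \<open>j\<close>.\<close>
  define \<beta> where "\<beta> = backpath \<theta> k m"
  have \<beta>: "awalk (head G (\<theta> m)) \<beta> (head G (\<theta> k))"
    unfolding \<beta>_def using km by (intro awalk_backpath[OF \<theta>]) simp
  have \<beta>_bounds: "\<xi>_minus a \<beta> \<le> \<xi> a (path_prefix \<theta> m) - K" "\<xi> a (path_prefix \<theta> m) - K < \<xi> a \<beta>"
  proof -
    have "\<xi>_minus a \<beta> = \<xi> a (backpath \<theta> (Suc k) m)"
      using butlast_backpath[OF km, of \<theta>] by (simp add: \<xi>_minus_def \<xi>_def \<beta>_def)
    moreover have "\<xi> a (path_prefix \<theta> k) + 1 \<le> \<xi> a (path_prefix \<theta> (Suc k))"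
      using a_pos[OF reversal_arcs[OF \<theta>]] by (simp add: path_prefix_Suc)
    ultimately show "\<xi>_minus a \<beta> \<le> \<xi> a (path_prefix \<theta> m) - K"
      using \<xi>_backpath[of "Suc k" m a \<theta>] km by (simp add: K_def)
    show "\<xi> a (path_prefix \<theta> m) - K < \<xi> a \<beta>"
      using \<xi>_backpath[of k m a \<theta>] km m by (simp add: K_def \<beta>_def)
  qed
  have neg_\<beta>: "neg_path_map f (path_prefix \<theta> k) = neg_path_map f (path_prefix \<theta> m) \<circ> path_map f \<beta>"
    unfolding \<beta>_def using km by (simp add: neg_path_map_backpath[OF \<theta>])
  \<comment> \<open>The image of the first central tile of \<open>\<psi>\<close> has address
    \<open>\<beta> @ \<sigma>\<^sub>0\<close> from the cut at \<open>m\<close> and lies in the tile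
    addressed by \<open>\<sigma>\<close>.\<close>
  have "E ` central_tile \<psi> 0 \<subseteq> E ` central_tile \<psi> j"
    using central_tile_mono[OF \<psi>] by (intro image_mono) simp
  then have "neg_path_map f (path_prefix \<theta> m) ` path_map f (\<beta> @ \<sigma>\<^sub>0) ` attractor G f w\<^sub>0 \<subseteq>
      neg_path_map f (path_prefix \<theta> m) ` path_map f \<sigma> ` attractor G f w"
    unfolding E0 Ej neg_\<beta> path_map_append by (simp add: image_comp comp_assoc)
  then have "path_map f (\<beta> @ \<sigma>\<^sub>0) ` attractor G f w\<^sub>0 \<subseteq> path_map f \<sigma> ` attractor G f w"
    using inj_image_subset_iff[OF bij_is_inj[OF neg_path_map_bij[OF \<theta>]]] by blast
  then have "prefix (\<beta> @ \<sigma>\<^sub>0) \<sigma> \<or> prefix \<sigma> (\<beta> @ \<sigma>\<^sub>0)"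
    by (rule attractor_image_subset_imp_comparable[OF awalk_appendI[OF \<beta> \<sigma>\<^sub>0] \<sigma>])
  \<comment> \<open>Either \<open>\<sigma>\<close> extends
    \<open>\<beta> @ \<sigma>\<^sub>0\<close>, or \<open>\<beta>\<close> and \<open>\<sigma>\<close>
    are prefixes of that same word. Comparable stopping paths of one level coincide.\<close>
  then have "prefix \<beta> \<sigma> \<or> prefix \<sigma> \<beta>"
    using append_prefixD prefix_same_cases[of \<sigma> "\<beta> @ \<sigma>\<^sub>0" \<beta>] by auto
  then have "\<beta> = \<sigma>"
    using stopping_paths_antichain \<beta>_bounds \<sigma>_bounds by metis
  moreover from this have "head G (\<theta> k) = w"
    using awlast_of_awalk[OF \<beta>] awlast_of_awalk[OF \<sigma>] by simp
  ultimately have "central_tile \<theta> k = neg_path_map f (path_prefix \<theta> m) ` path_map f \<sigma> ` attractor G f w"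
    by (simp add: central_tile_def neg_\<beta> image_comp)
  with Ej show thesis
    by (intro that) (rule trans[OF _ sym])
qed

end

section \<open>Factorisation of the isometry\<close>

lemma isometry_similitude: "isometry g \<Longrightarrow> similitude g"
  by (auto simp: isometry_def similitude_def similitude_with_def intro: exI[of _ 1])

lemma similitude_comp: "similitude g \<Longrightarrow> similitude h \<Longrightarrow> similitude (g \<circ> h)"
  unfolding similitude_def using similitude_with_comp by blast

lemma similitude_inv:
  fixes g :: "'a::euclidean_space \<Rightarrow> 'a"
  shows "similitude g \<Longrightarrow> similitude (inv g)"
  unfolding similitude_def using similitude_with_inv by blast

theorem theorem18:
  fixes G :: "('v, nat) pre_digraph"
    and f :: "nat \<Rightarrow> real ^ 'm \<Rightarrow> real ^ 'm"
    and s :: real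
    and a :: "nat \<Rightarrow> nat"
    and N :: nat
    and \<U> :: "(real ^ 'm \<Rightarrow> real ^ 'm) set"
    and E :: "real ^ 'm \<Rightarrow> real ^ 'm"
    and \<theta> \<psi> :: "nat \<Rightarrow> nat"
  assumes "tiling_IFS N G f s a"
    and "\<forall>g\<in>\<U>. isometry g"
    and "well_behaved G f s a \<U>"
    and "E \<in> \<U>"
    and "\<theta> \<in> inf_paths (reversal G)"
    and "\<psi> \<in> inf_paths (reversal G)"
    and "tiling G f a \<theta> = map_tiles E (tiling G f a \<psi>)"
  shows "\<exists>p\<ge>1. \<exists>q\<ge>1. \<exists>h\<in>arcs G. \<exists>e\<in>arcs G. \<exists>l\<in>{0..<Max (a ` arcs G)}. \<exists>V.
    similitude V \<and> V ` attractor G f (head G e) = attractor G f (head G h) \<and>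
    tail G h = prefix_end (reversal G) \<theta> p \<and>
    tail G e = prefix_end (reversal G) \<psi> q \<and>
    E = neg_path_map f (path_prefix \<theta> p) \<circ> (\<lambda>x. s ^ l *\<^sub>R x) \<circ> f h \<circ> V \<circ> inv (f e)
          \<circ> inv (neg_path_map f (path_prefix \<psi> q))"
proof -
  note \<theta> = assms(5) and \<psi> = assms(6)
  have ifs: "fin_digraph G" "arcs G = {1..N}" "strongly_connected G" "0 < N"
      "0 < s" "s < 1" "open_set_condition G f"
    and arc: "\<And>e. e \<in> arcs G \<Longrightarrow> 1 \<le> a e \<and> similitude_with (s ^ a e) (f e)"
    using assms(1) by (auto simp: tiling_IFS_def ifs_graph_def)
  interpret fin_digraph G
    by (rule ifs(1))
  interpret graph_IFS G f s a
    by unfold_locales (use ifs arc in auto)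
  have "supertiles K \<theta> = (\<lambda>t. E ` t) ` supertiles K \<psi>" if "1 \<le> K" for K
    using assms(3,4,7) \<theta> \<psi> that
    by (intro supertiles_eq_of_deflation_eq) (auto simp: well_behaved_def)
  then obtain k j where kj: "E ` central_tile \<psi> j = central_tile \<theta> k"
    using central_tiles_coincide[OF \<theta> \<psi>] by metis
  define P Q where "P = neg_path_map f (path_prefix \<theta> k)" and "Q = neg_path_map f (path_prefix \<psi> j)"
  have bij: "bij P" "bij Q"
    unfolding P_def Q_def by (rule neg_path_map_bij[OF \<theta>], rule neg_path_map_bij[OF \<psi>])
  \<comment> \<open>\<open>V\<close> is \<open>E\<close> expressed in the coordinates of the two
    coinciding central tiles.\<close>
  define V where "V = inv P \<circ> E \<circ> Q"
  have "similitude V"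
    unfolding V_def P_def Q_def using assms(2,4)
    by (intro similitude_comp similitude_inv neg_path_map_similitude \<theta> \<psi> isometry_similitude) auto
  moreover have "V ` attractor G f (head G (\<psi> j)) = attractor G f (head G (\<theta> k))"
  proof -
    have "V ` attractor G f (head G (\<psi> j)) = inv P ` E ` Q ` attractor G f (head G (\<psi> j))"
      by (simp add: V_def image_comp)
    also have "\<dots> = inv P ` P ` attractor G f (head G (\<theta> k))"
      using kj by (simp add: central_tile_def P_def Q_def)
    also have "\<dots> = attractor G f (head G (\<theta> k))"
      using bij_is_inj[OF bij(1)] by (simp add: image_inv_f_f)
    finally show ?thesis .
  qed
  moreover have "tail G (\<theta> k) = prefix_end (reversal G) \<theta> (Suc k)"
      "tail G (\<psi> j) = prefix_end (reversal G) \<psi> (Suc j)"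
    by (simp_all add: prefix_end_reversal \<theta> \<psi> reversal_tail)
  \<comment> \<open>This makes \<open>l = 0\<close> an admissible exponent.\<close>
  moreover have "0 < Max (a ` arcs G)"
  proof -
    have "a (\<theta> 0) \<le> Max (a ` arcs G)"
      using reversal_arcs[OF \<theta>] by (intro Max_ge) auto
    then show ?thesis
      using a_pos[OF reversal_arcs[OF \<theta>, of 0]] by simp
  qed
  \<comment> \<open>Lengthening each cut by one edge and undoing that edge with
    \<open>f (\<theta> k)\<close> or \<open>inv (f (\<psi> j))\<close> supplies \<open>h\<close> and
    \<open>e\<close> and makes \<open>p\<close> and \<open>q\<close> positive.\<close>
  moreover have "E = neg_path_map f (path_prefix \<theta> (Suc k)) \<circ> (\<lambda>x. s ^ 0 *\<^sub>R x) \<circ> f (\<theta> k) \<circ> V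
      \<circ> inv (f (\<psi> j)) \<circ> inv (neg_path_map f (path_prefix \<psi> (Suc j)))"
  proof -
    let ?P = "neg_path_map f (path_prefix \<theta> (Suc k))" and ?Q = "neg_path_map f (path_prefix \<psi> (Suc j))"
    have f: "bij (f (\<psi> j))"
      by (rule similitude_with_bij[OF f_similitude[OF reversal_arcs[OF \<psi>]]])
    have "inv Q = inv (f (\<psi> j)) \<circ> inv ?Q"
      unfolding Q_def neg_path_map_Suc_comp[OF \<psi>, of j, symmetric]
      by (rule o_inv_distrib[OF neg_path_map_bij[OF \<psi>] f])
    moreover have "P = ?P \<circ> f (\<theta> k)"
      unfolding P_def by (rule neg_path_map_Suc_comp[OF \<theta>, symmetric])
    moreover have "E = P \<circ> V \<circ> inv Q"
      using bij by (simp add: V_def fun_eq_iff bij_is_surj surj_f_inv_f)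
    ultimately show ?thesis
      by (simp add: comp_assoc fun_eq_iff)
  qed
  ultimately show ?thesis
    using reversal_arcs[OF \<theta>] reversal_arcs[OF \<psi>]
    by (intro exI[of _ "Suc k"] exI[of _ "Suc j"] conjI bexI[of _ "\<theta> k"] bexI[of _ "\<psi> j"]
        bexI[of _ 0] exI[of _ V]) auto
qed

end
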